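(* Let $A \in \mathbb{R}^{n\times n}$ and, for $x(0)\in\mathbb{R}^n$, let $x(t)=e^{At}x(0)$ denote the solution of $\dot x = A x$ with initial condition $x(0)$. Suppose that for every $x(0)\in\mathbb{R}^n$ the limit $x_\infty := \lim_{t\to\infty} x(t)$ exists. Then there exist complementary subspaces $\mathcal{M},\mathcal{N}$ of $\mathbb{R}^n$ such that $x_\infty = \Pi_{\mathcal{M},\mathcal{N}}\, x(0)$ for every $x(0)\in\mathbb{R}^n$. Moreover, whenever $A$ is written in the form $$A = T\begin{bmatrix} 0_{k\times k} & 0_{k\times (n-k)}\\ 0_{(n-k)\times k} & B\end{bmatrix}T^{-1}$$ with $T\in\mathbb{R}^{n\times n}$ nonsingular and $B\in\mathbb{R}^{(n-k)\times(n-k)}$ satisfying $\lambda_{\max}(B)<0$, and $t_1,\dots,t_k$ denote the first $k$ columns of $T$ and $\tau_1^{\mathsf T},\dots,\tau_k^{\mathsf T}$ denote the first $k$ rows of $T^{-1}$, these subspaces are given by $$\mathcal{M} = \operatorname{span}\{t_1,\dots,t_k\},\qquad \mathcal{N}^{\perp} = \operatorname{span}\{\tau_1,\dots,\tau_k\}.$$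
   Context: Subspaces $\mathcal{M},\mathcal{N}$ of $\mathbb{R}^n$ are complementary if $\mathcal{M}\cap\mathcal{N}=\{0\}$ and $\mathcal{M}+\mathcal{N}=\mathbb{R}^n$. For complementary $\mathcal{M},\mathcal{N}$, every $z\in\mathbb{R}^n$ has a unique decomposition $z=x+y$ with $x\in\mathcal{M}$, $y\in\mathcal{N}$; the projection onto $\mathcal{M}$ along $\mathcal{N}$ is the linear map $\Pi_{\mathcal{M},\mathcal{N}}z := x$. The orthogonal complement is $\mathcal{N}^\perp=\{x\in\mathbb{R}^n : x^{\mathsf T}y=0 \ \forall y\in\mathcal{N}\}$. For a square matrix $B$, $\lambda_{\max}(B)=\max\{\Re(\lambda):\lambda\in\sigma(B)\}$ is the spectral abscissa (the condition $\lambda_{\max}(B)<0$ is vacuous when $B$ is empty, i.e. $k=n$). *)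

theory Defs
  imports "Jordan_Normal_Form.Spectral_Radius" "Jordan_Normal_Form.VS_Connect"
begin

definition mat_exp :: "real mat \<Rightarrow> real mat" where
  "mat_exp A = mat (dim_row A) (dim_row A) (\<lambda>(i, j). \<Sum>m. (A ^\<^sub>m m) $$ (i, j) / fact m)"

text \<open>The carrier-based type of vectors has no topology, so convergence in \<open>\<real>\<^sup>n\<close> is
  componentwise convergence.\<close>

definition vec_tendsto :: "nat \<Rightarrow> ('t \<Rightarrow> real vec) \<Rightarrow> real vec \<Rightarrow> 't filter \<Rightarrow> bool" where
  "vec_tendsto n X L F \<longleftrightarrow> (\<forall>t. X t \<in> carrier_vec n) \<and> L \<in> carrier_vec n \<and>
     (\<forall>i<n. ((\<lambda>t. X t $ i) \<longlongrightarrow> L $ i) F)"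

abbreviation real_subspace :: "nat \<Rightarrow> real vec set \<Rightarrow> bool" where
  "real_subspace n W \<equiv> VectorSpace.subspace class_ring W (module_vec TYPE(real) n)"

abbreviation real_span :: "nat \<Rightarrow> real vec set \<Rightarrow> real vec set" where
  "real_span n S \<equiv> LinearCombinations.module.span class_ring (module_vec TYPE(real) n) S"

abbreviation real_orth :: "nat \<Rightarrow> real vec set \<Rightarrow> real vec set" where
  "real_orth n W \<equiv> vec_module.orthogonal_complement n W"

definition complementary :: "nat \<Rightarrow> real vec set \<Rightarrow> real vec set \<Rightarrow> bool" where
  "complementary n M N \<longleftrightarrow> real_subspace n M \<and> real_subspace n N \<and>
     M \<inter> N = {0\<^sub>v n} \<and> {x + y | x y. x \<in> M \<and> y \<in> N} = carrier_vec n"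

text \<open>Meaningful only for complementary subspaces, where the decomposition is unique.\<close>

definition proj_along :: "real vec set \<Rightarrow> real vec set \<Rightarrow> real vec \<Rightarrow> real vec" where
  "proj_along M N z = (THE x. x \<in> M \<and> (\<exists>y\<in>N. z = x + y))"

text \<open>The spectrum of a real matrix is its set of complex eigenvalues. For the \<open>0 \<times> 0\<close> matrix
  this is \<open>Max {}\<close>, which is unspecified.\<close>

definition spectral_abscissa :: "real mat \<Rightarrow> real" where
  "spectral_abscissa B = Max (Re ` spectrum (map_mat complex_of_real B))"

end

theory Submission
  imports Defs "Jordan_Normal_Form.Matrix_Kernel"
begin

text \<open>Let \<open>P\<close> be the matrix of the limit map, the entrywise limit of \<open>e\<^sup>t\<^sup>A\<close>. Everything follows from three
  identities, collected in \<open>mat_exp_limit\<close>: \<open>P A = 0\<close>, \<open>A P = 0\<close>, and \<open>P W = W\<close> whenever \<open>A W = 0\<close>.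
  The first holds because the entries of \<open>e\<^sup>t\<^sup>A\<close> converge and so do their derivatives, the entries of
  \<open>e\<^sup>t\<^sup>A A\<close>; by the mean value theorem a convergent derivative of a convergent function tends to zero.
  The second follows since \<open>A\<close> commutes with \<open>e\<^sup>t\<^sup>A\<close>, and the third since \<open>e\<^sup>t\<^sup>A W\<close> is constant in \<open>t\<close>.

  Taking \<open>W = P\<close> gives \<open>P\<^sup>2 = P\<close>, so \<open>P\<close> is the projection onto its fixed space along its kernel;
  these are the subspaces \<open>M\<close> and \<open>N\<close>.

  Now let \<open>A = T diag(0, B) T\<^sup>-\<^sup>1\<close> with \<open>B\<close> stable. The first \<open>k\<close> columns of \<open>T\<close> lie in the kernel of \<open>A\<close>,
  hence are fixed by \<open>P\<close>. Since \<open>0\<close> is not an eigenvalue of \<open>B\<close>, the matrix \<open>B\<close> is invertible, so the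
  other columns lie in the range of \<open>A\<close>, hence are annihilated by \<open>P\<close>. It follows that
  \<open>P = T diag(1, 0) T\<^sup>-\<^sup>1\<close> (\<open>limit_of_normal_form\<close>), and
  the fixed space of such a matrix is the span of the first \<open>k\<close> columns of \<open>T\<close>
  (\<open>fixed_space_conjugate\<close>). The description of \<open>N\<^sup>\<bottom>\<close> is the same fact for the transpose, because the
  orthogonal complement of the kernel of an idempotent \<open>P\<close> is the fixed space of its transpose
  (\<open>idempotent_orth\<close>).\<close>

section \<open>Entries of matrix products and powers\<close>

lemma index_mult_mat_sum:
  assumes "X \<in> carrier_mat a b" "Y \<in> carrier_mat b c" "i < a" "j < c"
  shows "(X * Y) $$ (i, j) = (\<Sum>l<b. X $$ (i, l) * Y $$ (l, j))"
  using assms by (auto simp: scalar_prod_def atLeast0LessThan intro!: sum.cong)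

lemma pow_mat_smult:
  fixes A :: "'a :: comm_semiring_1 mat"
  assumes A: "A \<in> carrier_mat n n"
  shows "(t \<cdot>\<^sub>m A) ^\<^sub>m m = t ^ m \<cdot>\<^sub>m (A ^\<^sub>m m)"
proof (induction m)
  case 0
  then show ?case using A by (intro eq_matI) auto
next
  case (Suc m)
  have "(t \<cdot>\<^sub>m A) ^\<^sub>m Suc m = (t ^ m \<cdot>\<^sub>m (A ^\<^sub>m m)) * (t \<cdot>\<^sub>m A)"
    using Suc by simp
  also have "\<dots> = t ^ Suc m \<cdot>\<^sub>m (A ^\<^sub>m Suc m)"
    using A by (intro eq_matI) (auto simp: ac_simps)
  finally show ?case .
qed

lemma pow_mat_commute:
  fixes A :: "'a :: semiring_1 mat"
  assumes A: "A \<in> carrier_mat n n"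
  shows "A * A ^\<^sub>m m = A ^\<^sub>m m * A"
proof (induction m)
  case 0
  then show ?case using A by simp
next
  case (Suc m)
  have "A * A ^\<^sub>m Suc m = (A * A ^\<^sub>m m) * A"
    using A by (simp add: assoc_mult_mat[of _ n n _ n _ n])
  then show ?case using Suc by simp
qed

text \<open>The sum of the absolute values of all entries is a submultiplicative norm, and it dominates every
  entry.\<close>
lemma pow_mat_entry_bound:
  fixes A :: "real mat"
  assumes A: "A \<in> carrier_mat n n" and ij: "i < n" "j < n"
  shows "\<bar>(A ^\<^sub>m m) $$ (i, j)\<bar> \<le> (\<Sum>k<n. \<Sum>l<n. \<bar>A $$ (k, l)\<bar>) ^ m"
    (is "_ \<le> ?a ^ m")
  using ij
proof (induction m arbitrary: j)
  case 0
  then show ?case using A by simp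
next
  case (Suc m)
  have "\<bar>(A ^\<^sub>m Suc m) $$ (i, j)\<bar> = \<bar>\<Sum>l<n. (A ^\<^sub>m m) $$ (i, l) * A $$ (l, j)\<bar>"
    using A Suc.prems by (simp add: index_mult_mat_sum[of _ n n _ n] del: index_mult_mat)
  also have "\<dots> \<le> (\<Sum>l<n. \<bar>(A ^\<^sub>m m) $$ (i, l)\<bar> * \<bar>A $$ (l, j)\<bar>)"
    by (rule order_trans[OF sum_abs]) (simp add: abs_mult)
  also have "\<dots> \<le> (\<Sum>l<n. ?a ^ m * \<bar>A $$ (l, j)\<bar>)"
    using Suc by (intro sum_mono mult_right_mono) auto
  also have "\<dots> = ?a ^ m * (\<Sum>l<n. \<bar>A $$ (l, j)\<bar>)"
    by (simp add: sum_distrib_left)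
  also have "\<dots> \<le> ?a ^ m * ?a"
  proof (rule mult_left_mono)
    show "(\<Sum>l<n. \<bar>A $$ (l, j)\<bar>) \<le> ?a"
      using Suc.prems by (intro sum_mono member_le_sum) auto
    show "0 \<le> ?a ^ m" by (simp add: add_nonneg_nonneg sum_nonneg)
  qed
  finally show ?case by (simp add: mult.commute)
qed

section \<open>The matrix exponential and its limit\<close>

lemma mat_exp_carrier:
  "A \<in> carrier_mat n n \<Longrightarrow> mat_exp (t \<cdot>\<^sub>m A) \<in> carrier_mat n n"
  by (simp add: mat_exp_def)

lemma mat_exp_sums:
  assumes A: "A \<in> carrier_mat n n" and ij: "i < n" "j < n"
  shows "(\<lambda>m. (A ^\<^sub>m m) $$ (i, j) / fact m * t ^ m) sums mat_exp (t \<cdot>\<^sub>m A) $$ (i, j)"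
proof -
  define a where "a = (\<Sum>k<n. \<Sum>l<n. \<bar>A $$ (k, l)\<bar>)"
  have "summable (\<lambda>m. (A ^\<^sub>m m) $$ (i, j) / fact m * t ^ m)"
  proof (rule summable_comparison_test[OF _ summable_exp[of "a * \<bar>t\<bar>"]], intro exI allI impI)
    fix m :: nat
    have "\<bar>(A ^\<^sub>m m) $$ (i, j)\<bar> * \<bar>t\<bar> ^ m \<le> a ^ m * \<bar>t\<bar> ^ m"
      using pow_mat_entry_bound[OF A ij, of m] by (intro mult_right_mono) (auto simp: a_def)
    then show "norm ((A ^\<^sub>m m) $$ (i, j) / fact m * t ^ m) \<le> inverse (fact m) * (a * \<bar>t\<bar>) ^ m"
      by (simp add: abs_mult power_abs power_mult_distrib divide_simps)
  qed
  moreover have "mat_exp (t \<cdot>\<^sub>m A) $$ (i, j) = (\<Sum>m. (A ^\<^sub>m m) $$ (i, j) / fact m * t ^ m)"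
    using A ij by (simp add: mat_exp_def pow_mat_smult[OF A] mult.commute)
  ultimately show ?thesis
    by (simp add: summable_sums)
qed

text \<open>Multiplying by a constant matrix is done inside the power series; both the derivative of the
  exponential and its commutation with \<open>A\<close> are then comparisons of coefficients.\<close>
lemma mat_exp_mult_sums:
  assumes A: "A \<in> carrier_mat n n" and W: "W \<in> carrier_mat n p" and ij: "i < n" "j < p"
  shows "(\<lambda>m. (A ^\<^sub>m m * W) $$ (i, j) / fact m * t ^ m) sums (mat_exp (t \<cdot>\<^sub>m A) * W) $$ (i, j)"
proof -
  have "(\<lambda>m. \<Sum>l<n. (A ^\<^sub>m m) $$ (i, l) / fact m * t ^ m * W $$ (l, j)) sums
      (\<Sum>l<n. mat_exp (t \<cdot>\<^sub>m A) $$ (i, l) * W $$ (l, j))"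
    using A ij by (intro sums_sum sums_mult2 mat_exp_sums) auto
  then show ?thesis
    using A W ij
    by (simp add: index_mult_mat_sum[of _ n n _ p] mat_exp_carrier sum_divide_distrib
        sum_distrib_left mult_ac del: index_mult_mat)
qed

lemma mult_mat_exp_sums:
  assumes A: "A \<in> carrier_mat n n" and W: "W \<in> carrier_mat p n" and ij: "i < p" "j < n"
  shows "(\<lambda>m. (W * A ^\<^sub>m m) $$ (i, j) / fact m * t ^ m) sums (W * mat_exp (t \<cdot>\<^sub>m A)) $$ (i, j)"
proof -
  have "(\<lambda>m. \<Sum>l<n. W $$ (i, l) * ((A ^\<^sub>m m) $$ (l, j) / fact m * t ^ m)) sums
      (\<Sum>l<n. W $$ (i, l) * mat_exp (t \<cdot>\<^sub>m A) $$ (l, j))"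
    using A ij by (intro sums_sum sums_mult mat_exp_sums) auto
  then show ?thesis
    using A W ij
    by (simp add: index_mult_mat_sum[of _ p n _ n] mat_exp_carrier sum_divide_distrib
        sum_distrib_left mult_ac del: index_mult_mat)
qed

lemma mat_exp_commute:
  assumes A: "A \<in> carrier_mat n n"
  shows "A * mat_exp (t \<cdot>\<^sub>m A) = mat_exp (t \<cdot>\<^sub>m A) * A"
proof (rule eq_matI)
  fix i j assume "i < dim_row (mat_exp (t \<cdot>\<^sub>m A) * A)" "j < dim_col (mat_exp (t \<cdot>\<^sub>m A) * A)"
  with A have ij: "i < n" "j < n" by (auto simp: mat_exp_def)
  show "(A * mat_exp (t \<cdot>\<^sub>m A)) $$ (i, j) = (mat_exp (t \<cdot>\<^sub>m A) * A) $$ (i, j)"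
    using mult_mat_exp_sums[OF A A ij, of t] mat_exp_mult_sums[OF A A ij, of t]
    unfolding pow_mat_commute[OF A] by (rule sums_unique2)
qed (use A in \<open>auto simp: mat_exp_def\<close>)

lemma mat_exp_zero:
  assumes A: "A \<in> carrier_mat n n"
  shows "mat_exp (0 \<cdot>\<^sub>m A) = 1\<^sub>m n"
proof (rule eq_matI)
  fix i j assume "i < dim_row (1\<^sub>m n)" "j < dim_col (1\<^sub>m n)"
  then have ij: "i < n" "j < n" by auto
  have "(\<lambda>m. (A ^\<^sub>m m) $$ (i, j) / fact m * 0 ^ m) sums ((A ^\<^sub>m 0) $$ (i, j) / fact 0)"
    by (rule powser_sums_zero)
  from sums_unique2[OF mat_exp_sums[OF A ij] this]
  show "mat_exp (0 \<cdot>\<^sub>m A) $$ (i, j) = 1\<^sub>m n $$ (i, j)" using A by simp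
qed (use A in \<open>auto simp: mat_exp_def\<close>)

lemma mat_exp_has_derivative:
  assumes A: "A \<in> carrier_mat n n" and W: "W \<in> carrier_mat n p" and ij: "i < n" "j < p"
  shows "((\<lambda>t. (mat_exp (t \<cdot>\<^sub>m A) * W) $$ (i, j)) has_real_derivative
    (mat_exp (t \<cdot>\<^sub>m A) * (A * W)) $$ (i, j)) (at t)"
proof -
  define c where "c = (\<lambda>m. (A ^\<^sub>m m * W) $$ (i, j) / fact m)"
  have AW: "A * W \<in> carrier_mat n p" using A W by simp
  have E: "(mat_exp (s \<cdot>\<^sub>m A) * W) $$ (i, j) = (\<Sum>m. c m * s ^ m)" for s
    using sums_unique[OF mat_exp_mult_sums[OF A W ij]] by (simp add: c_def)
  have "diffs c m = (A ^\<^sub>m m * (A * W)) $$ (i, j) / fact m" for m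
    using A W by (simp add: diffs_def c_def assoc_mult_mat[of _ n n _ n _ p] divide_simps
        del: index_mult_mat)
  then have E': "(mat_exp (t \<cdot>\<^sub>m A) * (A * W)) $$ (i, j) = (\<Sum>m. diffs c m * t ^ m)"
    using sums_unique[OF mat_exp_mult_sums[OF A AW ij]] by simp
  show ?thesis
    unfolding E E'
    by (rule termdiffs_strong_converges_everywhere)
      (use mat_exp_mult_sums[OF A W ij] in \<open>auto simp: c_def sums_iff\<close>)
qed

text \<open>By the mean value theorem \<open>f (t + 1) - f t\<close> is a value of \<open>f'\<close> at a point beyond \<open>t\<close>. As \<open>t\<close> grows, the
  difference tends to \<open>0\<close> and the value to \<open>L'\<close>.\<close>
lemma derivative_limit_zero:
  fixes f f' :: "real \<Rightarrow> real"
  assumes f: "(f \<longlongrightarrow> L) at_top" and f': "(f' \<longlongrightarrow> L') at_top"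
    and d: "\<And>t. (f has_real_derivative f' t) (at t)"
  shows "L' = 0"
proof -
  have "\<exists>z. t < z \<and> f (t + 1) - f t = f' z" for t
    using MVT2[of t "t + 1" f f'] d by auto
  then obtain z where z: "\<And>t. t < z t" "\<And>t. f (t + 1) - f t = f' (z t)" by metis
  have "filterlim z at_top at_top"
    by (rule filterlim_at_top_mono[OF filterlim_ident]) (use z in \<open>auto intro: less_imp_le always_eventually\<close>)
  then have "((\<lambda>t. f' (z t)) \<longlongrightarrow> L') at_top"
    by (rule filterlim_compose[OF f'])
  moreover have "filterlim (\<lambda>t::real. t + 1) at_top at_top"
    by (rule filterlim_at_top_mono[OF filterlim_ident]) auto
  then have "((\<lambda>t. f (t + 1) - f t) \<longlongrightarrow> L - L) at_top"
    by (intro tendsto_diff f filterlim_compose[OF f])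
  ultimately show ?thesis
    using tendsto_unique[of at_top "\<lambda>t. f' (z t)" L' 0] by (simp add: z(2))
qed

text \<open>The arbitrary matrix \<open>W\<close> lets one derivative formula serve twice: \<open>W = 1\<close> yields \<open>P A = 0\<close>, and
  \<open>A W = 0\<close> makes the derivative of \<open>e\<^sup>t\<^sup>A W\<close> vanish.\<close>
lemma mat_exp_limit:
  assumes A: "A \<in> carrier_mat n n" and P: "P \<in> carrier_mat n n"
    and lim: "\<And>i j. i < n \<Longrightarrow> j < n \<Longrightarrow> ((\<lambda>t. mat_exp (t \<cdot>\<^sub>m A) $$ (i, j)) \<longlongrightarrow> P $$ (i, j)) at_top"
  shows mat_exp_limit_mult: "P * A = 0\<^sub>m n n"
    and mult_mat_exp_limit: "A * P = 0\<^sub>m n n"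
    and mat_exp_limit_fixes_kernel: "\<And>W p. W \<in> carrier_mat n p \<Longrightarrow> A * W = 0\<^sub>m n p \<Longrightarrow> P * W = W"
proof -
  have limW: "((\<lambda>t. (mat_exp (t \<cdot>\<^sub>m A) * W) $$ (i, j)) \<longlongrightarrow> (P * W) $$ (i, j)) at_top"
    if "W \<in> carrier_mat n p" "i < n" "j < p" for W i j p
    using that A P
    by (simp add: index_mult_mat_sum[of _ n n _ p] mat_exp_carrier del: index_mult_mat)
      (intro tendsto_sum tendsto_mult_right lim, auto)
  have limW': "((\<lambda>t. (A * mat_exp (t \<cdot>\<^sub>m A)) $$ (i, j)) \<longlongrightarrow> (A * P) $$ (i, j)) at_top"
    if "i < n" "j < n" for i j
    using that A P
    by (simp add: index_mult_mat_sum[of _ n n _ n] mat_exp_carrier del: index_mult_mat)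
      (intro tendsto_sum tendsto_mult_left lim, auto)
  show PA: "P * A = 0\<^sub>m n n"
  proof (rule eq_matI)
    fix i j assume "i < dim_row (0\<^sub>m n n)" "j < dim_col (0\<^sub>m n n)"
    then have ij: "i < n" "j < n" by auto
    have "(P * A) $$ (i, j) = 0"
      using derivative_limit_zero[OF limW[OF one_carrier_mat ij] limW[OF A ij]]
        mat_exp_has_derivative[OF A one_carrier_mat ij] A by simp
    then show "(P * A) $$ (i, j) = 0\<^sub>m n n $$ (i, j)" using ij by simp
  qed (use A P in auto)
  have "A * P = P * A"
  proof (rule eq_matI)
    fix i j assume "i < dim_row (P * A)" "j < dim_col (P * A)"
    then have ij: "i < n" "j < n" using A P by auto
    show "(A * P) $$ (i, j) = (P * A) $$ (i, j)"
      using limW'[OF ij] limW[OF A ij] unfolding mat_exp_commute[OF A]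
      by (rule tendsto_unique[rotated]) simp
  qed (use A P in auto)
  with PA show "A * P = 0\<^sub>m n n" by simp
  show "P * W = W" if W: "W \<in> carrier_mat n p" and AW: "A * W = 0\<^sub>m n p" for W p
  proof (rule eq_matI)
    fix i j assume "i < dim_row W" "j < dim_col W"
    then have ij: "i < n" "j < p" using W by auto
    have "(mat_exp (t \<cdot>\<^sub>m A) * (A * W)) $$ (i, j) = 0" for t
      using ij A mat_exp_carrier[OF A, of t] by (simp add: AW)
    then have "(mat_exp (t \<cdot>\<^sub>m A) * W) $$ (i, j) = (mat_exp (0 \<cdot>\<^sub>m A) * W) $$ (i, j)" for t
      using mat_exp_has_derivative[OF A W ij] by (metis DERIV_isconst_all)
    then have "(mat_exp (t \<cdot>\<^sub>m A) * W) $$ (i, j) = W $$ (i, j)" for t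
      using W by (simp add: mat_exp_zero[OF A] del: index_mult_mat)
    with limW[OF W ij] show "(P * W) $$ (i, j) = W $$ (i, j)"
      by (simp add: tendsto_const_iff del: index_mult_mat)
  qed (use P W in auto)
qed

section \<open>Idempotent matrices as projections\<close>

definition fixed_space :: "nat \<Rightarrow> real mat \<Rightarrow> real vec set" where
  "fixed_space n P = {x \<in> carrier_vec n. P *\<^sub>v x = x}"

lemma real_subspaceI:
  assumes "W \<subseteq> carrier_vec n" "0\<^sub>v n \<in> W" "\<And>x y. x \<in> W \<Longrightarrow> y \<in> W \<Longrightarrow> x + y \<in> W"
    "\<And>c x. x \<in> W \<Longrightarrow> c \<cdot>\<^sub>v x \<in> W"
  shows "real_subspace n W"
proof -
  interpret vec_space "TYPE(real)" n .
  show ?thesis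
    unfolding subspace_def submodule_def using assms vectorspace_axioms module_axioms
    by (simp add: module_vec_simps class_ring_simps)
qed

lemma fixed_space_subspace:
  assumes "P \<in> carrier_mat n n"
  shows "real_subspace n (fixed_space n P)"
  using assms by (intro real_subspaceI)
    (auto simp: fixed_space_def mult_add_distrib_mat_vec[of _ n n] mult_mat_vec[of _ n n])

lemma mat_kernel_subspace:
  assumes P: "P \<in> carrier_mat n n"
  shows "real_subspace n (mat_kernel P)"
  using P by (intro real_subspaceI)
    (auto simp: mat_kernel[OF P] mult_add_distrib_mat_vec[of _ n n] mult_mat_vec[of _ n n])

lemma idempotent_residual:
  fixes P :: "real mat"
  assumes P: "P \<in> carrier_mat n n" "P * P = P" and z: "z \<in> carrier_vec n"
  shows "P *\<^sub>v z \<in> fixed_space n P" "z - P *\<^sub>v z \<in> mat_kernel P"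
    "P *\<^sub>v z + (z - P *\<^sub>v z) = z"
proof -
  have "P *\<^sub>v (P *\<^sub>v z) = P *\<^sub>v z"
    using assms by (metis assoc_mult_mat_vec)
  then show "P *\<^sub>v z \<in> fixed_space n P" "z - P *\<^sub>v z \<in> mat_kernel P"
    using P z by (auto simp: fixed_space_def mat_kernel[OF P(1)] mult_minus_distrib_mat_vec[of _ n n])
  show "P *\<^sub>v z + (z - P *\<^sub>v z) = z"
    using P z by (intro eq_vecI) auto
qed

lemma idempotent_complementary:
  assumes P: "P \<in> carrier_mat n n" "P * P = P"
  shows "complementary n (fixed_space n P) (mat_kernel P)"
proof -
  have "fixed_space n P \<inter> mat_kernel P = {0\<^sub>v n}"
    using P by (auto simp: fixed_space_def mat_kernel[OF P(1)])
  moreover have "{x + y | x y. x \<in> fixed_space n P \<and> y \<in> mat_kernel P} = carrier_vec n"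
  proof (intro equalityI subsetI)
    fix z assume "z \<in> {x + y | x y. x \<in> fixed_space n P \<and> y \<in> mat_kernel P}"
    then show "z \<in> carrier_vec n" by (auto simp: fixed_space_def mat_kernel[OF P(1)])
  next
    fix z :: "real vec" assume "z \<in> carrier_vec n"
    from idempotent_residual[OF P this]
    show "z \<in> {x + y | x y. x \<in> fixed_space n P \<and> y \<in> mat_kernel P}"
      unfolding mem_Collect_eq by metis
  qed
  ultimately show ?thesis
    using fixed_space_subspace mat_kernel_subspace P by (simp add: complementary_def)
qed

lemma idempotent_proj_along:
  assumes P: "P \<in> carrier_mat n n" "P * P = P" and z: "z \<in> carrier_vec n"
  shows "proj_along (fixed_space n P) (mat_kernel P) z = P *\<^sub>v z"
  unfolding proj_along_def
proof (rule the_equality)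
  show "P *\<^sub>v z \<in> fixed_space n P \<and> (\<exists>y\<in>mat_kernel P. z = P *\<^sub>v z + y)"
    using idempotent_residual[OF P z] by metis
next
  fix x assume "x \<in> fixed_space n P \<and> (\<exists>y\<in>mat_kernel P. z = x + y)"
  then obtain y where x: "x \<in> carrier_vec n" "P *\<^sub>v x = x"
    and y: "y \<in> carrier_vec n" "P *\<^sub>v y = 0\<^sub>v n" and "z = x + y"
    by (auto simp: fixed_space_def mat_kernel[OF P(1)])
  then show "x = P *\<^sub>v z" using P by (simp add: mult_add_distrib_mat_vec[of _ n n])
qed

text \<open>Every vector splits into its image under \<open>P\<close> and a kernel vector, so \<open>x\<close> is orthogonal to the kernel
  exactly if \<open>x \<bullet> z = x \<bullet> P z = P\<^sup>T x \<bullet> z\<close> for all \<open>z\<close>.\<close>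
lemma idempotent_orth:
  assumes P: "P \<in> carrier_mat n n" "P * P = P"
  shows "real_orth n (mat_kernel P) = fixed_space n (transpose_mat P)"
proof -
  have T: "transpose_mat P \<in> carrier_mat n n" using P by simp
  have adj: "(transpose_mat P *\<^sub>v x) \<bullet> z = x \<bullet> (P *\<^sub>v z)"
    if "x \<in> carrier_vec n" "z \<in> carrier_vec n" for x z
    using transpose_vec_mult_scalar P that by blast
  have "transpose_mat P *\<^sub>v x = x"
    if x: "x \<in> carrier_vec n" and o: "\<forall>y\<in>mat_kernel P. x \<bullet> y = 0" for x
  proof (rule eq_vecI)
    fix i assume "i < dim_vec x"
    then have i: "i < n" using x by simp
    let ?e = "unit_vec n i :: real vec"
    have "x \<bullet> ?e = x \<bullet> (P *\<^sub>v ?e + (?e - P *\<^sub>v ?e))"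
      using idempotent_residual(3)[OF P, of ?e] by simp
    also have "\<dots> = x \<bullet> (P *\<^sub>v ?e)"
      using idempotent_residual(2)[OF P, of ?e] o P x
      by (simp add: scalar_prod_add_distrib[of _ n])
    finally have "(transpose_mat P *\<^sub>v x) \<bullet> ?e = x \<bullet> ?e"
      using adj[OF x, of ?e] by simp
    moreover have "transpose_mat P *\<^sub>v x \<in> carrier_vec n" using T x by simp
    ultimately show "(transpose_mat P *\<^sub>v x) $ i = x $ i"
      using x i by (simp add: scalar_prod_right_unit del: index_mult_mat_vec)
  qed (use P x in simp)
  moreover have "x \<bullet> y = 0"
    if "x \<in> fixed_space n (transpose_mat P)" "y \<in> mat_kernel P" for x y
    using adj[of x y] that by (simp add: fixed_space_def mat_kernel[OF P(1)])
  ultimately show ?thesis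
    by (auto simp: vec_module.orthogonal_complement_def fixed_space_def)
qed

section \<open>Fixed spaces and spans of columns\<close>

definition coord_proj :: "nat \<Rightarrow> nat \<Rightarrow> real mat" where
  "coord_proj k n = mat n n (\<lambda>(i, j). if i = j \<and> i < k then 1 else 0)"

lemma coord_proj_carrier [simp]: "coord_proj k n \<in> carrier_mat n n"
  by (simp add: coord_proj_def)

lemma coord_proj_transpose: "transpose_mat (coord_proj k n) = coord_proj k n"
  by (intro eq_matI) (auto simp: coord_proj_def)

lemma coord_proj_mult_vec:
  assumes "y \<in> carrier_vec n"
  shows "coord_proj k n *\<^sub>v y = vec n (\<lambda>i. if i < k then y $ i else 0)"
proof (rule eq_vecI)
  fix i assume "i < dim_vec (vec n (\<lambda>i. if i < k then y $ i else 0))"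
  then have i: "i < n" by simp
  have "(coord_proj k n *\<^sub>v y) $ i = (\<Sum>l\<in>{0..<n}. (if i = l \<and> i < k then 1 else 0) * y $ l)"
    using i assms by (auto simp: coord_proj_def scalar_prod_def intro!: sum.cong)
  also have "\<dots> = (\<Sum>l\<in>{0..<n}. if i = l then (if i < k then y $ i else 0) else 0)"
    by (intro sum.cong) auto
  finally show "(coord_proj k n *\<^sub>v y) $ i = vec n (\<lambda>i. if i < k then y $ i else 0) $ i"
    using i by (simp del: index_mult_mat_vec)
qed (auto simp: coord_proj_def)

lemma mult_mat_vec_unit:
  fixes T :: "'a :: semiring_1 mat"
  assumes "T \<in> carrier_mat m n" "j < n"
  shows "T *\<^sub>v unit_vec n j = col T j"
  using assms by (intro eq_vecI) (auto simp: scalar_prod_right_unit)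

text \<open>Enlarging the number of retained coordinates one at a time adds one multiple of a column of \<open>T\<close> in
  each step. This way coinciding columns, which the image set identifies, do not matter.\<close>
lemma mult_coord_proj_in_span:
  assumes T: "T \<in> carrier_mat n n" and k: "k \<le> n" and y: "y \<in> carrier_vec n"
  shows "T *\<^sub>v (coord_proj k n *\<^sub>v y) \<in> real_span n (col T ` {..<k})"
proof -
  interpret vec_space "TYPE(real)" n .
  have S: "col T ` {..<k} \<subseteq> carrier_vec n" using T by auto
  have "T *\<^sub>v (coord_proj j n *\<^sub>v y) \<in> span (col T ` {..<k})" if "j \<le> k" for j
    using that
  proof (induction j)
    case 0
    have "coord_proj 0 n *\<^sub>v y = 0\<^sub>v n"
      using y by (intro eq_vecI) (auto simp: coord_proj_mult_vec simp del: index_mult_mat_vec)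
    moreover have "T *\<^sub>v 0\<^sub>v n = 0\<^sub>v n" using T by (intro eq_vecI) auto
    ultimately show ?case using span_zero by simp
  next
    case (Suc j)
    have "coord_proj (Suc j) n *\<^sub>v y = coord_proj j n *\<^sub>v y + y $ j \<cdot>\<^sub>v unit_vec n j"
      using y Suc.prems k
      by (intro eq_vecI) (auto simp: coord_proj_mult_vec less_Suc_eq simp del: index_mult_mat_vec)
    then have "T *\<^sub>v (coord_proj (Suc j) n *\<^sub>v y)
        = T *\<^sub>v (coord_proj j n *\<^sub>v y) + y $ j \<cdot>\<^sub>v col T j"
      using mult_add_distrib_mat_vec[OF T, of "coord_proj j n *\<^sub>v y" "y $ j \<cdot>\<^sub>v unit_vec n j"]
        mult_mat_vec[OF T unit_vec_carrier, of "y $ j" j] mult_mat_vec_unit[OF T, of j]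
        mult_mat_vec_carrier[OF coord_proj_carrier y] Suc.prems k by simp
    moreover have "y $ j \<cdot>\<^sub>v col T j \<in> span (col T ` {..<k})"
      using S Suc.prems by (intro smult_in_span) (auto intro: span_mem)
    ultimately show ?case using Suc span_add1[OF S] by simp
  qed
  then show ?thesis by simp
qed

lemma fixed_space_conjugate:
  assumes T: "T \<in> carrier_mat n n" "T' \<in> carrier_mat n n"
    and inv: "T' * T = 1\<^sub>m n" and k: "k \<le> n"
  shows "fixed_space n (T * coord_proj k n * T') = real_span n (col T ` {..<k})"
proof
  let ?P = "T * coord_proj k n * T'"
  have P: "?P \<in> carrier_mat n n" using T coord_proj_carrier by (metis mult_carrier_mat)
  have eq: "?P *\<^sub>v x = T *\<^sub>v (coord_proj k n *\<^sub>v (T' *\<^sub>v x))" if "x \<in> carrier_vec n" for x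
    using T that by (simp add: assoc_mult_mat_vec[of _ n n _ n])
  show "fixed_space n ?P \<subseteq> real_span n (col T ` {..<k})"
  proof
    fix x assume "x \<in> fixed_space n ?P"
    then have "x \<in> carrier_vec n" "x = T *\<^sub>v (coord_proj k n *\<^sub>v (T' *\<^sub>v x))"
      using eq by (auto simp: fixed_space_def)
    then show "x \<in> real_span n (col T ` {..<k})"
      using mult_coord_proj_in_span[OF T(1) k, of "T' *\<^sub>v x"] T(2) by simp
  qed
  have "col T j \<in> fixed_space n ?P" if j: "j < k" for j
  proof -
    have jn: "j < n" using j k by simp
    have "T' *\<^sub>v col T j = unit_vec n j"
      using col_mult2[OF T(2,1) jn] inv jn by simp
    moreover have "coord_proj k n *\<^sub>v unit_vec n j = unit_vec n j"
      using j jn by (intro eq_vecI) (auto simp: coord_proj_mult_vec simp del: index_mult_mat_vec)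
    ultimately show ?thesis
      using T jn eq[of "col T j"] by (simp add: fixed_space_def mult_mat_vec_unit)
  qed
  then have sub: "col T ` {..<k} \<subseteq> fixed_space n ?P" by auto
  interpret vec_space "TYPE(real)" n .
  have "submodule class_ring (fixed_space n ?P) V"
    using fixed_space_subspace[OF P] by simp
  then show "real_span n (col T ` {..<k}) \<subseteq> fixed_space n ?P"
    using span_is_subset[OF sub] by simp
qed

section \<open>The limit in block form\<close>

text \<open>A singular \<open>B\<close> has the eigenvalue \<open>0\<close>, which forces the spectral abscissa to be at least \<open>0\<close>. The empty
  matrix, where the hypothesis is vacuous, is invertible since its determinant is \<open>1\<close>.\<close>
lemma negative_abscissa_inverse:
  assumes B: "B \<in> carrier_mat m m" and neg: "0 < m \<longrightarrow> spectral_abscissa B < 0"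
  obtains C where "C \<in> carrier_mat m m" "B * C = 1\<^sub>m m"
proof -
  have "det B \<noteq> 0"
  proof (cases "m = 0")
    case True
    then show ?thesis using B by (simp add: det_dim_zero)
  next
    case False
    let ?B = "map_mat complex_of_real B"
    have cB: "?B \<in> carrier_mat m m" using B by simp
    show ?thesis
    proof
      assume "det B = 0"
      then have "det ?B = 0" by (simp add: of_real_hom.hom_det)
      then obtain w where "w \<in> carrier_vec m" "w \<noteq> 0\<^sub>v m" "?B *\<^sub>v w = 0\<^sub>v m"
        using det_0_iff_vec_prod_zero[OF cB] by auto
      then have "0 \<in> spectrum ?B"
        using B by (auto simp: spectrum_def eigenvalue_def eigenvector_def intro!: exI[of _ w])
      then have "Re 0 \<le> spectral_abscissa B"
        unfolding spectral_abscissa_def using card_finite_spectrum(1)[OF cB]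
        by (intro Max_ge imageI finite_imageI)
      then show False using neg False by simp
    qed
  qed
  then show thesis
    using det_non_zero_imp_unit[OF B] that by (auto simp: Units_def ring_mat_def)
qed

text \<open>With \<open>D = diag(0, B)\<close> one has \<open>A T = T D\<close>. The identity matrix splits into \<open>K = diag(1, 0)\<close> and
  \<open>J = diag(0, 1) = D diag(0, B\<^sup>-\<^sup>1)\<close>. Then \<open>A T K = 0\<close>, so \<open>P\<close> fixes \<open>T K\<close>, while \<open>T J\<close> is a multiple
  \<open>A X\<close> of \<open>A\<close>, so \<open>P T J = 0\<close>. Adding up, \<open>P T = T K\<close>.\<close>
lemma limit_of_normal_form:
  assumes P: "P \<in> carrier_mat n n" and PA: "P * A = 0\<^sub>m n n"
    and fixed: "\<And>W. W \<in> carrier_mat n n \<Longrightarrow> A * W = 0\<^sub>m n n \<Longrightarrow> P * W = W"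
    and k: "k \<le> n" and T: "T \<in> carrier_mat n n" "T' \<in> carrier_mat n n"
    and inv: "T * T' = 1\<^sub>m n" "T' * T = 1\<^sub>m n"
    and B: "B \<in> carrier_mat (n - k) (n - k)" and C: "C \<in> carrier_mat (n - k) (n - k)" "B * C = 1\<^sub>m (n - k)"
    and A: "A = T * four_block_mat (0\<^sub>m k k) (0\<^sub>m k (n - k)) (0\<^sub>m (n - k) k) B * T'"
  shows "P = T * coord_proj k n * T'"
proof -
  let ?blk = "\<lambda>U V. four_block_mat U (0\<^sub>m k (n - k)) (0\<^sub>m (n - k) k) V :: real mat"
  define D where "D = ?blk (0\<^sub>m k k) B"
  define S where "S = ?blk (0\<^sub>m k k) C"
  define J where "J = ?blk (0\<^sub>m k k) (1\<^sub>m (n - k))"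
  let ?K = "coord_proj k n"
  have K: "?K = ?blk (1\<^sub>m k) (0\<^sub>m (n - k) (n - k))"
    using k by (intro eq_matI) (simp_all add: coord_proj_def)
  have car: "D \<in> carrier_mat n n" "S \<in> carrier_mat n n" "J \<in> carrier_mat n n"
    using four_block_carrier_mat[OF zero_carrier_mat B] four_block_carrier_mat[OF zero_carrier_mat C(1)]
      four_block_carrier_mat[OF zero_carrier_mat one_carrier_mat[of "n - k"], of k k] k
    unfolding D_def S_def J_def by (metis le_add_diff_inverse)+
  have KJ: "?K + J = 1\<^sub>m n"
    using k by (intro eq_matI) (simp_all add: coord_proj_def J_def, arith)
  have DS: "D * S = J" unfolding D_def S_def J_def
    using B C by (subst mult_four_block_mat[of _ k k _ "n - k" _ "n - k" _ _ k _ "n - k"]) simp_all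
  have DK: "D * ?K = 0\<^sub>m n n" unfolding D_def K
    using B k by (subst mult_four_block_mat[of _ k k _ "n - k" _ "n - k" _ _ k _ "n - k"]) simp_all
  note assoc = assoc_mult_mat[of _ n n _ n _ n]
  have AT: "A * (T * X) = T * (D * X)" if X: "X \<in> carrier_mat n n" for X
  proof -
    have "A * (T * X) = T * (D * ((T' * T) * X))"
      using T X car by (simp add: A D_def[symmetric] assoc)
    then show ?thesis using X inv by simp
  qed
  have "P * (T * ?K) = T * ?K"
    using T AT[of ?K] by (intro fixed) (simp_all add: DK)
  moreover have "P * (T * J) = 0\<^sub>m n n"
  proof -
    have "P * (T * J) = (P * A) * (T * S)"
      using AT[OF car(2)] P T car A by (simp add: DS assoc D_def[symmetric])
    then show ?thesis using T car by (simp add: PA)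
  qed
  ultimately have "P * (T * (?K + J)) = T * ?K"
    using P T car by (simp add: mult_add_distrib_mat[of _ n n _ n])
  then have "P * T = T * ?K" using P T by (simp add: KJ)
  then have "T * ?K * T' = P * (T * T')" using P T by (simp add: assoc[symmetric])
  then show ?thesis using P inv by simp
qed

section \<open>Limits of solutions\<close>

theorem mainTheorem1:
  fixes n :: nat and A :: "real mat" and x_inf :: "real vec \<Rightarrow> real vec"
  assumes "A \<in> carrier_mat n n"
    and "\<And>x0. x0 \<in> carrier_vec n \<Longrightarrow>
      vec_tendsto n (\<lambda>t. mat_exp (t \<cdot>\<^sub>m A) *\<^sub>v x0) (x_inf x0) at_top"
  shows "\<exists>M N. complementary n M N \<and>
    (\<forall>x0 \<in> carrier_vec n. x_inf x0 = proj_along M N x0) \<and>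
    (\<forall>k T T' B.
      k \<le> n \<longrightarrow>
      T \<in> carrier_mat n n \<longrightarrow> T' \<in> carrier_mat n n \<longrightarrow>
      inverts_mat T T' \<longrightarrow> inverts_mat T' T \<longrightarrow>
      B \<in> carrier_mat (n - k) (n - k) \<longrightarrow>
      (k < n \<longrightarrow> spectral_abscissa B < 0) \<longrightarrow>
      A = T * four_block_mat (0\<^sub>m k k) (0\<^sub>m k (n - k)) (0\<^sub>m (n - k) k) B * T' \<longrightarrow>
      M = real_span n (col T ` {..<k}) \<and>
      real_orth n N = real_span n (row T' ` {..<k}))"
proof -
  note A = assms(1)
  define P where "P = mat n n (\<lambda>(i, j). x_inf (unit_vec n j) $ i)"
  have P: "P \<in> carrier_mat n n" by (simp add: P_def)
  have lim: "((\<lambda>t. mat_exp (t \<cdot>\<^sub>m A) $$ (i, j)) \<longlongrightarrow> P $$ (i, j)) at_top"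
    if ij: "i < n" "j < n" for i j
  proof -
    have "(mat_exp (t \<cdot>\<^sub>m A) *\<^sub>v unit_vec n j) $ i = mat_exp (t \<cdot>\<^sub>m A) $$ (i, j)" for t
      using mat_exp_carrier[OF A, of t] ij by (simp add: mult_mat_vec_unit)
    moreover have "((\<lambda>t. (mat_exp (t \<cdot>\<^sub>m A) *\<^sub>v unit_vec n j) $ i) \<longlongrightarrow> x_inf (unit_vec n j) $ i) at_top"
      using assms(2)[of "unit_vec n j"] ij by (simp add: vec_tendsto_def del: index_mult_mat_vec)
    ultimately show ?thesis
      using ij by (simp add: P_def)
  qed
  have PA: "P * A = 0\<^sub>m n n" by (rule mat_exp_limit_mult[OF A P]) (rule lim)
  have AP: "A * P = 0\<^sub>m n n" by (rule mult_mat_exp_limit[OF A P]) (rule lim)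
  have Pfix: "P * W = W" if "W \<in> carrier_mat n n" "A * W = 0\<^sub>m n n" for W
    using that by (rule mat_exp_limit_fixes_kernel[OF A P, rotated]) (rule lim)
  have PP: "P * P = P" using Pfix[OF P AP] .
  have x_inf: "x_inf x = P *\<^sub>v x" if x: "x \<in> carrier_vec n" for x
  proof (rule eq_vecI)
    note vt = assms(2)[OF x, unfolded vec_tendsto_def]
    then show "dim_vec (x_inf x) = dim_vec (P *\<^sub>v x)" using P by auto
    fix i assume "i < dim_vec (P *\<^sub>v x)"
    then have i: "i < n" using P by simp
    have "((\<lambda>t. \<Sum>l<n. mat_exp (t \<cdot>\<^sub>m A) $$ (i, l) * x $ l) \<longlongrightarrow> (\<Sum>l<n. P $$ (i, l) * x $ l)) at_top"
      using i by (intro tendsto_sum tendsto_mult_right lim) auto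
    moreover have "(X *\<^sub>v x) $ i = (\<Sum>l<n. X $$ (i, l) * x $ l)" if "X \<in> carrier_mat n n" for X
      using that i x by (auto simp: scalar_prod_def atLeast0LessThan intro!: sum.cong)
    ultimately have "((\<lambda>t. (mat_exp (t \<cdot>\<^sub>m A) *\<^sub>v x) $ i) \<longlongrightarrow> (P *\<^sub>v x) $ i) at_top"
      using P mat_exp_carrier[OF A] by (simp del: index_mult_mat_vec)
    with vt i show "x_inf x $ i = (P *\<^sub>v x) $ i"
      using tendsto_unique[OF trivial_limit_at_top_linorder] by blast
  qed
  show ?thesis
  proof (rule exI[of _ "fixed_space n P"], rule exI[of _ "mat_kernel P"],
      intro conjI ballI allI impI)
    show "complementary n (fixed_space n P) (mat_kernel P)"
      by (rule idempotent_complementary[OF P PP])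
    show "x_inf x = proj_along (fixed_space n P) (mat_kernel P) x" if "x \<in> carrier_vec n" for x
      using that by (simp add: x_inf idempotent_proj_along[OF P PP])
  next
    fix k T T' B
    assume k: "k \<le> n" and T: "T \<in> carrier_mat n n" "T' \<in> carrier_mat n n"
      and inv: "inverts_mat T T'" "inverts_mat T' T"
      and B: "B \<in> carrier_mat (n - k) (n - k)" "k < n \<longrightarrow> spectral_abscissa B < 0"
      and form: "A = T * four_block_mat (0\<^sub>m k k) (0\<^sub>m k (n - k)) (0\<^sub>m (n - k) k) B * T'"
    from inv T have inv: "T * T' = 1\<^sub>m n" "T' * T = 1\<^sub>m n" by (auto simp: inverts_mat_def)
    obtain C where C: "C \<in> carrier_mat (n - k) (n - k)" "B * C = 1\<^sub>m (n - k)"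
      using negative_abscissa_inverse[OF B(1)] B(2) by auto
    have PT: "P = T * coord_proj k n * T'"
      by (rule limit_of_normal_form[OF P PA Pfix k T inv B(1) C form])
    show "fixed_space n P = real_span n (col T ` {..<k})"
      unfolding PT by (rule fixed_space_conjugate[OF T inv(2) k])
    let ?t = transpose_mat
    have Tt: "?t T \<in> carrier_mat n n" "?t T' \<in> carrier_mat n n" using T by auto
    have tP: "?t P = ?t T' * coord_proj k n * ?t T"
      using T transpose_mult[OF mult_carrier_mat[OF T(1) coord_proj_carrier] T(2), of k]
        transpose_mult[OF T(1) coord_proj_carrier, of k]
      by (simp add: PT coord_proj_transpose assoc_mult_mat[of _ n n _ n _ n])
    have "?t T * ?t T' = 1\<^sub>m n" using transpose_mult[OF T(2,1)] inv(2) by simp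
    then have "fixed_space n (?t P) = real_span n (col (?t T') ` {..<k})"
      unfolding tP by (rule fixed_space_conjugate[OF Tt(2,1) _ k])
    also have "col (?t T') ` {..<k} = row T' ` {..<k}"
      using T k by (intro image_cong) auto
    finally show "real_orth n (mat_kernel P) = real_span n (row T' ` {..<k})"
      by (simp add: idempotent_orth[OF P PP])
  qed
qed

end
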